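(* Let $\{E^{[s,t]} : s,t\in\mathbb R,\ 0\le s\le t\}$ be a chain of $n$-dimensional evolution algebras over $\mathbb R$ with matrices of structural constants $\mathcal M^{[s,t]}$. Then $E^{[s,t]}$ is nilpotent for any $(s,t)$ with $0\le s\le t$ if and only if $\mathcal M^{[s,t]}=0$ for any $(s,t)$ with $0\le s\le t$.
   Context: A family $\{E^{[s,t]}: s,t\in\mathbb R,\ 0\le s\le t\}$ of $n$-dimensional evolution algebras over $\mathbb R$ consists of algebras with basis $\{e_1,\dots,e_n\}$ and multiplication table $e_ie_i=\sum_{j=1}^n a_{ij}^{[s,t]}e_j$ for $i=1,\dots,n$, and $e_ie_j=0$ for $i\neq j$. Its matrix of structural constants is $\mathcal M^{[s,t]}=(a_{ij}^{[s,t]})_{i,j=1}^n$. The family is called a chain of evolution algebras if $\mathcal M^{[s,t]}=\mathcal M^{[s,\tau]}\mathcal M^{[\tau,t]}$ for any $s<\tau<t$ (the Chapman–Kolmogorov equation). An algebra $\mathcal A$ is called nilpotent if there exists $m\in\mathbb N$ such that $\mathcal A^m=0$, where $\mathcal A^1=\mathcal A$ and $\mathcal A^k=\sum_{i=1}^{k-1}\mathcal A^i\mathcal A^{k-i}$ for $k\ge 2$.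
   Formalization: As stated the claim fails at s = t, since Chapman–Kolmogorov for s<τ<t leaves M^{[t,t]} free (e.g. E_12). It is proved for all 0 ≤ s < t, and for all 0 ≤ s ≤ t under the added condition M^{[s,s]} = M^{[s,s]}M^{[s,s]} for every s ≥ 0. *)

theory Defs
  imports "HOL-Analysis.Analysis"
begin

text \<open>An algebra is given by its bilinear, not necessarily associative or commutative,
  product on a real vector space (the whole type).\<close>

definition subspace_prod ::
    "('a::real_vector \<Rightarrow> 'a \<Rightarrow> 'a) \<Rightarrow> 'a set \<Rightarrow> 'a set \<Rightarrow> 'a set" where
  "subspace_prod f U V = span {f u v | u v. u \<in> U \<and> v \<in> V}"

text \<open>The sum of a family of subspaces is the span of their union.  The value at
  exponent 0 is a dummy; \<open>nilpotent_algebra\<close> only uses exponents \<open>m \<ge> 1\<close>.\<close>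

fun algebra_power :: "('a::real_vector \<Rightarrow> 'a \<Rightarrow> 'a) \<Rightarrow> nat \<Rightarrow> 'a set" where
  "algebra_power f k =
     (if k \<le> 1 then UNIV
      else span (\<Union>i\<in>{1..<k}.
             subspace_prod f (algebra_power f i) (algebra_power f (k - i))))"

declare algebra_power.simps [simp del]

definition nilpotent_algebra :: "('a::real_vector \<Rightarrow> 'a \<Rightarrow> 'a) \<Rightarrow> bool" where
  "nilpotent_algebra f \<longleftrightarrow> (\<exists>m\<ge>1. algebra_power f m = {0})"

definition indexed_basis :: "('n::finite \<Rightarrow> 'a::real_vector) \<Rightarrow> bool" where
  "indexed_basis e \<longleftrightarrow> inj e \<and> independent (range e) \<and> span (range e) = UNIV"

definition evolution_algebra ::
    "('n::finite \<Rightarrow> 'a::real_vector) \<Rightarrow> ('a \<Rightarrow> 'a \<Rightarrow> 'a) \<Rightarrow> real^'n^'n \<Rightarrow> bool" where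
  "evolution_algebra e f A \<longleftrightarrow>
     indexed_basis e \<and> bilinear f \<and>
     (\<forall>i. f (e i) (e i) = (\<Sum>j\<in>UNIV. A $ i $ j *\<^sub>R e j)) \<and>
     (\<forall>i j. i \<noteq> j \<longrightarrow> f (e i) (e j) = 0)"

definition chain_of_evolution_algebras ::
    "('n::finite \<Rightarrow> 'a::real_vector) \<Rightarrow> (real \<Rightarrow> real \<Rightarrow> 'a \<Rightarrow> 'a \<Rightarrow> 'a)
      \<Rightarrow> (real \<Rightarrow> real \<Rightarrow> real^'n^'n) \<Rightarrow> bool" where
  "chain_of_evolution_algebras e E M \<longleftrightarrow>
     (\<forall>s t. 0 \<le> s \<and> s \<le> t \<longrightarrow> evolution_algebra e (E s t) (M s t)) \<and>
     (\<forall>s \<tau> t. 0 \<le> s \<and> s < \<tau> \<and> \<tau> < t \<longrightarrow> M s t = M s \<tau> ** M \<tau> t)"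

text \<open>The Chapman--Kolmogorov equation, required for \<open>s < \<tau> < t\<close> only, never involves the
  matrices \<open>M t t\<close>.  Hence nilpotency of all \<open>E s t\<close> with \<open>0 \<le> s \<le> t\<close> forces \<open>M s t = 0\<close>
  only for \<open>s < t\<close>, as the following two-dimensional chain shows.\<close>

lemma nilpotent_chain_nonzero_diagonal:
  defines "e \<equiv> (\<lambda>i::2. axis i (1::real))"
    and "E \<equiv> (\<lambda>(s::real) t x y. if s = t then (x $ 1 * y $ 1) *\<^sub>R axis 2 1 else (0 :: real^2))"
    and "M \<equiv> (\<lambda>(s::real) t. if s = t then \<chi> i j. if i = 1 \<and> j = 2 then 1 else (0::real) else 0)"
  shows "chain_of_evolution_algebras e E M"
    and "nilpotent_algebra (E s t)"
    and "M t t \<noteq> (0 :: real^2^2)"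
proof -
  have "evolution_algebra e (E s t) (M s t)" for s t
  proof -
    have "inj e" by (auto simp: e_def inj_on_def axis_eq_axis)
    moreover have r: "range e = Basis"
      by (auto simp: e_def Basis_vec_def)
    moreover have "bilinear (E s t)"
      by (auto simp: bilinear_def E_def intro!: linearI simp: algebra_simps)
    moreover have "E s t (e i) (e i) = (\<Sum>j\<in>UNIV. M s t $ i $ j *\<^sub>R e j)" for i
      using exhaust_2[of i] by (auto simp: E_def M_def e_def sum_2 axis_def)
    moreover have "E s t (e i) (e j) = 0" if "i \<noteq> j" for i j
      using that exhaust_2[of i] exhaust_2[of j] by (auto simp: E_def e_def axis_def)
    ultimately show ?thesis
      by (simp add: evolution_algebra_def indexed_basis_def independent_Basis)
  qed
  then show "chain_of_evolution_algebras e E M"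
    by (simp add: chain_of_evolution_algebras_def M_def)
  let ?L = "span {axis 2 1 :: real^2}"
  have L: "x $ 1 = 0" if "x \<in> ?L" for x
    using that by (auto simp: span_singleton axis_def)
  have EL: "E s t x y \<in> ?L" for x y
    by (auto simp: E_def intro: span_base span_scale span_zero)
  have "subspace_prod (E s t) U V \<subseteq> ?L" for U V
    unfolding subspace_prod_def using EL by (intro span_minimal) auto
  then have "algebra_power (E s t) 2 \<subseteq> ?L"
    by (subst algebra_power.simps) (simp add: UN_least span_minimal)
  then have p2: "x $ 1 = 0" if "x \<in> algebra_power (E s t) 2" for x
    using L that by blast
  have i3: "{1..<3::nat} = {1, 2}" by auto
  have z: "E s t x y = 0" if "x $ 1 = 0 \<or> y $ 1 = 0" for x y
    using that by (auto simp: E_def)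
  have "algebra_power (E s t) 3 \<subseteq> {0}"
  proof -
    have "subspace_prod (E s t) U V \<subseteq> {0}"
      if "(\<forall>x\<in>U. x $ 1 = 0) \<or> (\<forall>x\<in>V. x $ 1 = 0)" for U V
      unfolding subspace_prod_def using that z by (intro span_minimal) auto
    note zero = this
    have "subspace_prod (E s t) (algebra_power (E s t) i) (algebra_power (E s t) (3 - i)) \<subseteq> {0}"
      if "i \<in> {1, 2}" for i
      using that p2 by (intro zero) auto
    then have "(\<Union>i\<in>{1..<3}. subspace_prod (E s t) (algebra_power (E s t) i)
        (algebra_power (E s t) (3 - i))) \<subseteq> {0}"
      unfolding i3 by (intro UN_least)
    then have "span (\<Union>i\<in>{1..<3}. subspace_prod (E s t) (algebra_power (E s t) i)
        (algebra_power (E s t) (3 - i))) \<subseteq> {0}"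
      by (rule span_minimal) simp
    then show ?thesis
      by (subst algebra_power.simps) simp
  qed
  moreover have "0 \<in> algebra_power (E s t) 3"
    by (subst algebra_power.simps) (simp add: span_zero)
  ultimately show "nilpotent_algebra (E s t)"
    unfolding nilpotent_algebra_def by (intro exI[of _ 3]) auto
  show "M t t \<noteq> (0 :: real^2^2)"
    by (auto simp: M_def vec_eq_iff intro!: exI[of _ 1])
qed

end

theory Submission
  imports Defs "HOL-Library.Ramsey"
begin

text \<open>A cycle in the graph of nonzero structural constants of an evolution algebra carries
  nonzero squares \<open>e\<^sub>i e\<^sub>i\<close> into every power of the algebra, so for a nilpotent algebra this
  graph is acyclic. There are only finitely many graphs on \<open>n\<close> vertices; by Ramsey's theorem
  there are \<open>a < b < c\<close> in any interval for which the matrices of \<open>(a, b)\<close>, \<open>(b, c)\<close> and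
  \<open>(a, c)\<close> all have the same graph \<open>G\<close>. The Chapman--Kolmogorov equation then yields
  \<open>G \<subseteq> G O G\<close>, and a finite acyclic graph with this property has no edges.\<close>

definition support_graph :: "'b::zero^'n^'n \<Rightarrow> ('n \<times> 'n) set" where
  "support_graph A = {(i, j). A $ i $ j \<noteq> 0}"

lemma support_graph_eq_empty_iff: "support_graph A = {} \<longleftrightarrow> A = 0"
  by (auto simp: support_graph_def vec_eq_iff)

lemma support_graph_matrix_mult:
  fixes A B :: "'b::semiring_1^'n::finite^'n"
  shows "support_graph (A ** B) \<subseteq> support_graph A O support_graph B"
proof
  fix p assume "p \<in> support_graph (A ** B)"
  then obtain i j where p: "p = (i, j)" and "(\<Sum>k\<in>UNIV. A $ i $ k * B $ k $ j) \<noteq> 0"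
    by (auto simp: support_graph_def matrix_matrix_mult_def)
  then obtain k where "A $ i $ k * B $ k $ j \<noteq> 0"
    by (meson sum.not_neutral_contains_not_neutral)
  then show "p \<in> support_graph A O support_graph B"
    unfolding p support_graph_def by (intro relcompI[of _ k]) auto
qed

text \<open>A vertex with an outgoing edge would have a successor with an outgoing edge, so a path
  could be prolonged forever. The induction runs backwards along edges, starting at the
  sinks.\<close>

lemma acyclic_subset_relcomp_self_empty:
  assumes "finite G" "acyclic G" "G \<subseteq> G O G"
  shows "G = {}"
proof -
  have "wf (G\<inverse>)"
    using assms by (intro finite_acyclic_wf_converse)
  then have "\<forall>j. (i, j) \<notin> G" for i
  proof (induction i rule: wf_induct_rule)
    case (less i)
    then show ?case using assms(3) by blast
  qed
  then show ?thesis by auto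
qed

text \<open>Right multiplication by \<open>e j\<close> kills all terms of the expansion of the
  square of \<open>e i\<close> except the \<open>j\<close>-th. This is how squares travel along an
  edge from \<open>i\<close> to \<open>j\<close>.\<close>

lemma evolution_algebra_square_mult:
  assumes "evolution_algebra e f A"
  shows "f (f (e i) (e i)) (e j) = (A $ i $ j) *\<^sub>R f (e j) (e j)"
proof -
  have lin: "linear (\<lambda>x. f x (e j))" and orth: "\<And>k. k \<noteq> j \<Longrightarrow> f (e k) (e j) = 0"
    and sq: "f (e i) (e i) = (\<Sum>k\<in>UNIV. A $ i $ k *\<^sub>R e k)"
    using assms by (auto simp: evolution_algebra_def bilinear_def)
  have "f (f (e i) (e i)) (e j) = (\<Sum>k\<in>UNIV. A $ i $ k *\<^sub>R f (e k) (e j))"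
    unfolding sq by (simp add: linear_sum[OF lin] linear_cmul[OF lin])
  also have "\<dots> = (\<Sum>k\<in>{j}. A $ i $ k *\<^sub>R f (e k) (e j))"
    by (rule sum.mono_neutral_right) (auto simp: orth)
  finally show ?thesis by simp
qed

lemma evolution_algebra_square_nonzero:
  assumes "evolution_algebra e f A" "(i, j) \<in> support_graph A"
  shows "f (e i) (e i) \<noteq> 0"
proof
  assume zero: "f (e i) (e i) = 0"
  have inj: "inj e" and ind: "independent (range e)"
    and sq: "f (e i) (e i) = (\<Sum>k\<in>UNIV. A $ i $ k *\<^sub>R e k)"
    using assms by (auto simp: evolution_algebra_def indexed_basis_def)
  \<comment> \<open>\<open>independentD\<close> wants coefficients indexed by vectors, hence the
    reindexing through \<open>inv e\<close>.\<close>
  have "(\<Sum>v\<in>range e. A $ i $ inv e v *\<^sub>R v) = 0"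
    using zero sq inj by (simp add: sum.reindex)
  then have "A $ i $ inv e (e j) = 0"
    using independentD[OF ind, of "range e" "\<lambda>v. A $ i $ inv e v"] by auto
  then show False
    using assms(2) inj by (simp add: support_graph_def)
qed

lemma algebra_power_mult_Suc:
  assumes "m \<ge> 1" "x \<in> algebra_power f m"
  shows "f x y \<in> algebra_power f (Suc m)"
proof -
  have "y \<in> algebra_power f 1"
    by (subst algebra_power.simps) simp
  then have "f x y \<in> subspace_prod f (algebra_power f m) (algebra_power f (Suc m - m))"
    unfolding subspace_prod_def using assms by (intro span_base) auto
  then show ?thesis
    using assms(1) by (subst algebra_power.simps) (auto intro!: span_base bexI[of _ m])
qed

text \<open>The predecessor \<open>p\<close> of \<open>i\<close> on the cycle is itself on a cycle,
  so by induction its square lies in the power \<open>m\<close>. Multiplying it by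
  \<open>e i\<close> puts a nonzero multiple of the square of \<open>e i\<close> into the next
  power.\<close>

lemma cycle_square_in_algebra_power:
  assumes "evolution_algebra e f A" "m \<ge> 1" "(i, i) \<in> (support_graph A)\<^sup>+"
  shows "f (e i) (e i) \<in> algebra_power f m"
  using assms(2,3)
proof (induction m arbitrary: i rule: dec_induct)
  case base
  show ?case by (subst algebra_power.simps) simp
next
  case (step m)
  obtain p where ip: "(i, p) \<in> (support_graph A)\<^sup>*" and pi: "(p, i) \<in> support_graph A"
    using step.prems by (meson tranclD2)
  then have "(p, p) \<in> (support_graph A)\<^sup>+"
    by (rule rtrancl_into_trancl2[rotated])
  then have "f (f (e p) (e p)) (e i) \<in> algebra_power f (Suc m)"
    using step by (intro algebra_power_mult_Suc) auto
  \<comment> \<open>As \<open>Suc m\<close> is at least 2, the power unfolds to a span, which allows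
    division by the structural constant.\<close>
  then have "(1 / A $ p $ i) *\<^sub>R (A $ p $ i *\<^sub>R f (e i) (e i)) \<in> algebra_power f (Suc m)"
    using \<open>1 \<le> m\<close> unfolding evolution_algebra_square_mult[OF assms(1)]
    by (subst (asm) algebra_power.simps, subst algebra_power.simps)
      (simp add: span_scale del: scaleR_scaleR)
  then show ?case
    using pi by (simp add: support_graph_def)
qed

lemma nilpotent_evolution_algebra_acyclic:
  assumes "evolution_algebra e f A" "nilpotent_algebra f"
  shows "acyclic (support_graph A)"
proof (rule acyclicI, intro allI notI)
  fix i assume cyc: "(i, i) \<in> (support_graph A)\<^sup>+"
  obtain m where "m \<ge> 1" "algebra_power f m = {0}"
    using assms(2) by (auto simp: nilpotent_algebra_def)
  then have "f (e i) (e i) = 0"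
    using cycle_square_in_algebra_power[OF assms(1) _ cyc] by blast
  moreover obtain j where "(i, j) \<in> support_graph A"
    using cyc by (meson tranclD)
  ultimately show False
    using evolution_algebra_square_nonzero[OF assms(1)] by blast
qed

lemma evolution_algebra_zero_matrix_nilpotent:
  assumes "evolution_algebra e f 0"
  shows "nilpotent_algebra f"
proof -
  have bil: "bilinear f" and sp: "span (range e) = UNIV"
    using assms by (auto simp: evolution_algebra_def indexed_basis_def)
  have "f (e i) (e j) = 0" for i j
    using assms by (cases "i = j") (auto simp: evolution_algebra_def)
  then have f0: "f x y = 0" for x y
    using bilinear_eq[of f "\<lambda>_ _. 0" UNIV "range e" UNIV "range e" x y] bil sp
    by (auto simp: bilinear_def linear_zero)
  have "{1..<2::nat} = {1}" by auto
  then have "algebra_power f 2 = {0}"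
    by (subst algebra_power.simps) (simp add: subspace_prod_def f0 algebra_power.simps)
  then show ?thesis
    unfolding nilpotent_algebra_def by (intro exI[of _ 2]) simp
qed

lemma Ramsey_finite_type_triple:
  fixes c :: "real \<Rightarrow> real \<Rightarrow> 'c::finite"
  assumes "s < t"
  obtains x y z where "s < x" "x < y" "y < z" "z < t" "c x y = c y z" "c x y = c x z"
proof -
  obtain h :: "'c \<Rightarrow> nat" and n where h: "h ` UNIV = {i. i < n}" "inj h"
    using finite_imp_inj_to_nat_seg[of "UNIV :: 'c set"] by auto
  \<comment> \<open>\<open>Ramsey2\<close> colours unordered pairs by naturals below
    \<open>n\<close>: \<open>Min\<close> and \<open>Max\<close> restore the order of the arguments
    of \<open>c\<close>, and \<open>h\<close> numbers its values.\<close>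
  define g where "g X = h (c (Min X) (Max X))" for X
  have "\<forall>x\<in>{s<..<t}. \<forall>y\<in>{s<..<t}. x \<noteq> y \<longrightarrow> g {x, y} < n"
    using h by (auto simp: g_def)
  then obtain Y k where Y: "Y \<subseteq> {s<..<t}" "infinite Y"
    and hom: "\<forall>x\<in>Y. \<forall>y\<in>Y. x \<noteq> y \<longrightarrow> g {x, y} = k"
    using Ramsey2[of "{s<..<t}" g n] assms by (auto simp: infinite_Ioo)
  obtain F where F: "F \<subseteq> Y" "finite F" "card F = 3"
    using infinite_arbitrarily_large[OF Y(2)] by blast
  define xs where "xs = sorted_list_of_set F"
  have xs: "set xs = F" "length xs = 3" "sorted_wrt (<) xs"
    using F by (auto simp: xs_def)
  then obtain x y z where "xs = [x, y, z]"
    by (auto simp: numeral_3_eq_3 length_Suc_conv)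
  then have xyz: "x \<in> Y" "y \<in> Y" "z \<in> Y" "x < y" "y < z"
    using xs F by auto
  have col: "h (c u v) = k" if "u \<in> Y" "v \<in> Y" "u < v" for u v
    using hom that by (force simp: g_def min_def max_def)
  have "h (c x y) = h (c y z)" "h (c x y) = h (c x z)"
    using col xyz by auto
  then have "c x y = c y z" "c x y = c x z"
    using h(2) by (simp_all add: inj_eq)
  moreover have "s < x" "z < t"
    using xyz Y(1) by auto
  ultimately show thesis
    using that xyz by blast
qed

text \<open>The diagonal is treated separately because of
  \<open>nilpotent_chain_nonzero_diagonal\<close>; the extra assumption there is the
  Chapman--Kolmogorov equation at three equal times.\<close>

theorem theorem3:
  fixes e :: "'n::finite \<Rightarrow> 'a::real_vector"
    and E :: "real \<Rightarrow> real \<Rightarrow> 'a \<Rightarrow> 'a \<Rightarrow> 'a"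
    and M :: "real \<Rightarrow> real \<Rightarrow> real^'n^'n"
  assumes "chain_of_evolution_algebras e E M"
  shows "((\<forall>s t. 0 \<le> s \<and> s < t \<longrightarrow> nilpotent_algebra (E s t)) \<longleftrightarrow>
           (\<forall>s t. 0 \<le> s \<and> s < t \<longrightarrow> M s t = 0)) \<and>
         ((\<forall>s\<ge>0. M s s = M s s ** M s s) \<longrightarrow>
           ((\<forall>s t. 0 \<le> s \<and> s \<le> t \<longrightarrow> nilpotent_algebra (E s t)) \<longleftrightarrow>
            (\<forall>s t. 0 \<le> s \<and> s \<le> t \<longrightarrow> M s t = 0)))"
proof -
  have evo: "evolution_algebra e (E s t) (M s t)" if "0 \<le> s" "s \<le> t" for s t
    using assms that by (auto simp: chain_of_evolution_algebras_def)
  have ck: "M s t = M s r ** M r t" if "0 \<le> s" "s < r" "r < t" for s r t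
    using assms that by (auto simp: chain_of_evolution_algebras_def)
  have zero_nilpotent: "nilpotent_algebra (E s t)" if "0 \<le> s" "s \<le> t" "M s t = 0" for s t
    using evo[OF that(1,2)] that(3) evolution_algebra_zero_matrix_nilpotent by metis
  \<comment> \<open>Common core of the two cases: the Ramsey triple supplies the inclusion off the
    diagonal, idempotency supplies it on the diagonal.\<close>
  have idempotent_zero: "M s t = 0"
    if "0 \<le> s" "s \<le> t" "nilpotent_algebra (E s t)"
      and "support_graph (M s t) \<subseteq> support_graph (M s t) O support_graph (M s t)" for s t
    using acyclic_subset_relcomp_self_empty[OF finite _ that(4)]
      nilpotent_evolution_algebra_acyclic[OF evo[OF that(1,2)] that(3)]
    by (simp add: support_graph_eq_empty_iff)
  have off_diagonal: "M s t = 0"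
    if nil: "\<forall>s t. 0 \<le> s \<and> s < t \<longrightarrow> nilpotent_algebra (E s t)" and st: "0 \<le> s" "s < t" for s t
  proof -
    obtain x y z where xyz: "s < x" "x < y" "y < z" "z < t"
      and "support_graph (M x y) = support_graph (M y z)"
        "support_graph (M x y) = support_graph (M x z)"
      using Ramsey_finite_type_triple[OF st(2), of "\<lambda>x y. support_graph (M x y)"] by blast
    then have "support_graph (M x z) \<subseteq> support_graph (M x z) O support_graph (M x z)"
      using support_graph_matrix_mult[of "M x y" "M y z"] ck[of x y z] st by auto
    then have "M x z = 0"
      using idempotent_zero[of x z] nil xyz st by auto
    \<comment> \<open>Since \<open>x\<close> and \<open>z\<close> lie strictly between
      \<open>s\<close> and \<open>t\<close>, the vanishing matrix \<open>M x z\<close> is a factor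
      of \<open>M s t\<close>.\<close>
    moreover have "M s t = M s x ** (M x z ** M z t)"
      using ck[of s x t] ck[of x z t] xyz st by simp
    ultimately show ?thesis by simp
  qed
  have diagonal: "M s s = 0"
    if "M s s = M s s ** M s s" "0 \<le> s" "nilpotent_algebra (E s s)" for s
    using idempotent_zero[of s s] support_graph_matrix_mult[of "M s s" "M s s"] that by simp
  show ?thesis
    using zero_nilpotent off_diagonal diagonal
    by (smt (verit, best))
qed

end
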